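(* Let $R$ be a ring. Then the following are equivalent: (1) $R$ is a uniquely $\Delta$-clean ring; (2) $R$ is a strongly $\Delta$-clean ring and all idempotents of $R$ are central.
   Context: Rings are associative with identity, not necessarily commutative. $U(R)$ is the group of units of $R$. Define $\Delta(R)=\{x\in R \mid 1-xu\in U(R)\text{ for all }u\in U(R)\}$. A ring $R$ is strongly $\Delta$-clean if every $a\in R$ can be written $a=e+d$ with $e^2=e\in R$, $d\in\Delta(R)$ and $ed=de$. A ring $R$ is uniquely $\Delta$-clean if every $a\in R$ can be written as $a=e+d$ with $e^2=e\in R$ and $d\in\Delta(R)$, and this representation is unique (no commutation is required). *)

theory Defs
  imports "HOL-Algebra.Ring"
begin

text \<open>
  The locale \<^locale>\<open>ring\<close> is associative and unital; it does not assume commutativity, and the zero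
  ring is allowed.
\<close>

definition Delta :: "('a, 'm) ring_scheme \<Rightarrow> 'a set" where
  "Delta R = {x \<in> carrier R. \<forall>u \<in> Units R. \<one>\<^bsub>R\<^esub> \<ominus>\<^bsub>R\<^esub> x \<otimes>\<^bsub>R\<^esub> u \<in> Units R}"

definition Idempotents :: "('a, 'm) ring_scheme \<Rightarrow> 'a set" where
  "Idempotents R = {e \<in> carrier R. e \<otimes>\<^bsub>R\<^esub> e = e}"

definition ring_center :: "('a, 'm) ring_scheme \<Rightarrow> 'a set" where
  "ring_center R = {z \<in> carrier R. \<forall>x \<in> carrier R. z \<otimes>\<^bsub>R\<^esub> x = x \<otimes>\<^bsub>R\<^esub> z}"

definition strongly_Delta_clean :: "('a, 'm) ring_scheme \<Rightarrow> bool" where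
  "strongly_Delta_clean R \<longleftrightarrow>
     (\<forall>a \<in> carrier R. \<exists>e \<in> Idempotents R. \<exists>d \<in> Delta R.
        a = e \<oplus>\<^bsub>R\<^esub> d \<and> e \<otimes>\<^bsub>R\<^esub> d = d \<otimes>\<^bsub>R\<^esub> e)"

text \<open>The representation is unique as a pair \<open>(e, d)\<close>, with no commutation required of \<open>e\<close> and \<open>d\<close>.\<close>

definition uniquely_Delta_clean :: "('a, 'm) ring_scheme \<Rightarrow> bool" where
  "uniquely_Delta_clean R \<longleftrightarrow>
     (\<forall>a \<in> carrier R. \<exists>!p. p \<in> Idempotents R \<times> Delta R \<and> a = fst p \<oplus>\<^bsub>R\<^esub> snd p)"

end

theory Submission
  imports Defs "HOL-Algebra.Multiplicative_Group"
begin

text \<open>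
  An element \<open>x\<close> lies in \<open>Delta R\<close> iff \<open>x + U(R) \<subseteq> U(R)\<close>, so \<open>Delta R\<close> is an additive subgroup.

  Suppose \<open>R\<close> is uniquely \<open>\<Delta>\<close>-clean and \<open>n\<^sup>2 = 0\<close>. Writing the unit \<open>1 + n\<close> as \<open>g + d\<close>, the
  idempotent \<open>g = (1 + n) - d\<close> is a unit, so \<open>g = 1\<close> and \<open>n = d\<close> lies in \<open>Delta R\<close>. If \<open>e\<close> is
  idempotent and \<open>n\<close> is \<open>er - ere\<close> or \<open>re - ere\<close>, then \<open>e + n\<close> is idempotent too, and its two
  representations \<open>(e + n) + 0\<close> and \<open>e + n\<close> force \<open>n = 0\<close>; hence \<open>er = ere = re\<close>.

  Conversely, if \<open>e + d = f + d'\<close> with \<open>e\<close> and \<open>f\<close> commuting idempotents, then \<open>e - f\<close> lies in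
  \<open>Delta R\<close>. As \<open>1 - 2f\<close> is its own inverse, \<open>1 - (e - f)(1 - 2f) = 1 - (e - f)\<^sup>2\<close> is a unit and an
  idempotent, hence \<open>1\<close>, so that \<open>e - f = 0\<close>.
\<close>

context ring
begin

section \<open>Signed sums and units\<close>

text \<open>Cancellation rules for \<open>simp\<close> with \<open>a_ac\<close>, whose term ordering
  can leave \<open>x\<close> and \<open>\<ominus> x\<close> separated by another summand.\<close>

lemma add_cancels:
  assumes "x \<in> carrier R" "y \<in> carrier R" "z \<in> carrier R"
  shows "x \<oplus> \<ominus> x = \<zero>" "\<ominus> x \<oplus> x = \<zero>"
    and "x \<oplus> (\<ominus> x \<oplus> y) = y" "\<ominus> x \<oplus> (x \<oplus> y) = y"
    and "x \<oplus> (y \<oplus> \<ominus> x) = y" "\<ominus> x \<oplus> (y \<oplus> x) = y"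
    and "x \<oplus> (y \<oplus> (\<ominus> x \<oplus> z)) = y \<oplus> z" "\<ominus> x \<oplus> (y \<oplus> (x \<oplus> z)) = y \<oplus> z"
proof -
  \<comment> \<open>These equations carry \<open>y\<close> to the right past \<open>x\<close> or
    \<open>\<ominus> x\<close>, so that opposite summands become adjacent.\<close>
  have "y \<oplus> w = w \<oplus> y" "y \<oplus> (w \<oplus> z) = w \<oplus> (y \<oplus> z)" if "w \<in> carrier R" for w
    using assms that by (simp_all add: a_comm a_lcomm)
  from this[of x] this[of "\<ominus> x"] assms
  show "x \<oplus> \<ominus> x = \<zero>" "\<ominus> x \<oplus> x = \<zero>"
    and "x \<oplus> (\<ominus> x \<oplus> y) = y" "\<ominus> x \<oplus> (x \<oplus> y) = y"
    and "x \<oplus> (y \<oplus> \<ominus> x) = y" "\<ominus> x \<oplus> (y \<oplus> x) = y"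
    and "x \<oplus> (y \<oplus> (\<ominus> x \<oplus> z)) = y \<oplus> z" "\<ominus> x \<oplus> (y \<oplus> (x \<oplus> z)) = y \<oplus> z"
    by (simp_all add: r_neg l_neg r_neg1 r_neg2)
qed

lemma Units_memI:
  assumes "x \<in> carrier R" "y \<in> carrier R" "x \<otimes> y = \<one>" "y \<otimes> x = \<one>"
  shows "x \<in> Units R"
  using assms unfolding Units_def by auto

lemma Units_a_inv_closed:
  assumes "u \<in> Units R"
  shows "\<ominus> u \<in> Units R"
proof -
  have "\<ominus> \<one> \<otimes> u \<in> Units R"
    using assms by (intro Units_m_closed Units_minus_one_closed)
  then show ?thesis
    using assms by (simp add: l_minus Units_closed)
qed

lemma idempotent_unit_eq_one:
  assumes "e \<in> Units R" "e \<otimes> e = e"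
  shows "e = \<one>"
  using assms by (metis Units_closed Units_l_cancel one_closed r_one)

lemma one_add_square_zero_Units:
  assumes "n \<in> carrier R" "n \<otimes> n = \<zero>"
  shows "\<one> \<oplus> n \<in> Units R"
proof -
  have "(\<one> \<oplus> n) \<otimes> (\<one> \<ominus> n) = \<one>" "(\<one> \<ominus> n) \<otimes> (\<one> \<oplus> n) = \<one>"
    using assms by (simp_all add: minus_eq l_distr r_distr l_minus r_minus a_assoc l_neg r_neg)
  then show ?thesis
    using assms by (intro Units_memI[of _ "\<one> \<ominus> n"]) simp_all
qed

section \<open>The additive group \<open>Delta R\<close>\<close>

lemma Delta_closed: "x \<in> Delta R \<Longrightarrow> x \<in> carrier R"
  by (simp add: Delta_def)

text \<open>For v = -u^-1 one has u + x = (1 - x v) u, and v runs through all units as u does. In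
  the additive form, closure under sums and negation is a matter of regrouping.\<close>

lemma Delta_iff:
  "x \<in> Delta R \<longleftrightarrow> x \<in> carrier R \<and> (\<forall>u \<in> Units R. u \<oplus> x \<in> Units R)"
proof (intro iffI conjI ballI)
  fix u assume x: "x \<in> Delta R" and u: "u \<in> Units R"
  let ?v = "\<ominus> (inv u)"
  have v: "?v \<in> Units R"
    using u by (simp add: Units_a_inv_closed)
  have "\<one> \<ominus> x \<otimes> ?v \<in> Units R"
    using x v by (simp add: Delta_def)
  then have "(\<one> \<ominus> x \<otimes> ?v) \<otimes> u \<in> Units R"
    using u by simp
  moreover have "(\<one> \<ominus> x \<otimes> ?v) \<otimes> u = u \<oplus> x"
    using Delta_closed[OF x] u
    by (simp add: minus_eq l_distr r_minus m_assoc Units_closed)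
  ultimately show "u \<oplus> x \<in> Units R"
    by simp
next
  assume x: "x \<in> carrier R \<and> (\<forall>u \<in> Units R. u \<oplus> x \<in> Units R)"
  have "\<one> \<ominus> x \<otimes> u \<in> Units R" if u: "u \<in> Units R" for u
  proof -
    have "(\<ominus> (inv u) \<oplus> x) \<otimes> \<ominus> u \<in> Units R"
      using x u by (simp add: Units_a_inv_closed)
    moreover have "(\<ominus> (inv u) \<oplus> x) \<otimes> \<ominus> u = \<one> \<ominus> x \<otimes> u"
      using x u by (simp add: minus_eq l_distr l_minus r_minus minus_add Units_closed)
    ultimately show ?thesis
      by simp
  qed
  with x show "x \<in> Delta R"
    by (simp add: Delta_def)
qed (rule Delta_closed)

lemma zero_in_Delta: "\<zero> \<in> Delta R"
  by (simp add: Delta_iff Units_closed)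

lemma Delta_add:
  assumes "x \<in> Delta R" "y \<in> Delta R"
  shows "x \<oplus> y \<in> Delta R"
  using assms by (auto simp add: Delta_iff Units_closed simp flip: a_assoc)

lemma Delta_a_inv:
  assumes "x \<in> Delta R"
  shows "\<ominus> x \<in> Delta R"
proof -
  have "u \<oplus> \<ominus> x \<in> Units R" if u: "u \<in> Units R" for u
  proof -
    have "\<ominus> (\<ominus> u \<oplus> x) \<in> Units R"
      using assms u by (simp add: Delta_iff Units_a_inv_closed)
    then show ?thesis
      using assms u by (simp add: Delta_closed Units_closed minus_add)
  qed
  with assms show ?thesis
    by (simp add: Delta_iff)
qed

section \<open>Unique representations and central idempotents\<close>

lemma uniquely_Delta_clean_exists:
  assumes "uniquely_Delta_clean R" "a \<in> carrier R"
  obtains e d where "e \<in> Idempotents R" "d \<in> Delta R" "a = e \<oplus> d"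
proof -
  obtain p where "p \<in> Idempotents R \<times> Delta R" "a = fst p \<oplus> snd p"
    using assms unfolding uniquely_Delta_clean_def by meson
  then show thesis
    using that[of "fst p" "snd p"] by (simp add: mem_Times_iff)
qed

lemma uniquely_Delta_clean_unique:
  assumes "uniquely_Delta_clean R" "e \<in> Idempotents R" "f \<in> Idempotents R"
    and "d \<in> Delta R" "d' \<in> Delta R" "e \<oplus> d = f \<oplus> d'"
  shows "e = f" "d = d'"
proof -
  have "e \<oplus> d \<in> carrier R"
    using assms by (simp add: Idempotents_def Delta_closed)
  then have "\<exists>!p. p \<in> Idempotents R \<times> Delta R \<and> e \<oplus> d = fst p \<oplus> snd p"
    using assms(1) by (simp add: uniquely_Delta_clean_def)
  then have "(e, d) = (f, d')"
    by (rule ex1E) (metis SigmaI assms(2-) fst_conv snd_conv)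
  then show "e = f" "d = d'"
    by simp_all
qed

lemma square_zero_in_Delta:
  assumes "uniquely_Delta_clean R" "n \<in> carrier R" "n \<otimes> n = \<zero>"
  shows "n \<in> Delta R"
proof -
  obtain g d where g: "g \<in> Idempotents R" and d: "d \<in> Delta R" and eq: "\<one> \<oplus> n = g \<oplus> d"
    using assms uniquely_Delta_clean_exists[of "\<one> \<oplus> n"] by auto
  have gc: "g \<in> carrier R" "g \<otimes> g = g"
    using g by (simp_all add: Idempotents_def)
  have "(\<one> \<oplus> n) \<oplus> \<ominus> d \<in> Units R"
    using one_add_square_zero_Units[OF assms(2,3)] Delta_a_inv[OF d] by (simp add: Delta_iff)
  then have "g \<in> Units R"
    using gc Delta_closed[OF d] by (simp add: eq a_assoc r_neg)
  then have "g = \<one>"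
    using gc by (simp add: idempotent_unit_eq_one)
  then have "n = d"
    using eq assms(2) Delta_closed[OF d] by simp
  with d show ?thesis
    by simp
qed

text \<open>The third condition on \<open>n\<close> covers both er - ere, where en = n and ne = 0,
  and re - ere, where en = 0 and ne = n.\<close>

lemma square_zero_eq_zero:
  assumes "uniquely_Delta_clean R" "e \<in> Idempotents R"
    and n: "n \<in> carrier R" "n \<otimes> n = \<zero>" "e \<otimes> n \<oplus> n \<otimes> e = n"
  shows "n = \<zero>"
proof -
  have e: "e \<in> carrier R" "e \<otimes> e = e"
    using assms(2) by (simp_all add: Idempotents_def)
  have "(e \<oplus> n) \<otimes> (e \<oplus> n) = e \<oplus> (e \<otimes> n \<oplus> n \<otimes> e)"
    using e n(1,2) by (simp add: l_distr r_distr a_ac)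
  then have "e \<oplus> n \<in> Idempotents R"
    using e n by (simp add: Idempotents_def)
  moreover have "e \<oplus> n = (e \<oplus> n) \<oplus> \<zero>"
    using e n by simp
  ultimately show ?thesis
    using assms square_zero_in_Delta zero_in_Delta uniquely_Delta_clean_unique(2) by metis
qed

lemma uniquely_Delta_clean_Idempotents_central:
  assumes "uniquely_Delta_clean R"
  shows "Idempotents R \<subseteq> ring_center R"
proof
  fix e assume e: "e \<in> Idempotents R"
  then have ec: "e \<in> carrier R" and ee: "e \<otimes> e = e"
    by (simp_all add: Idempotents_def)
  \<comment> \<open>Reassociating to the right by \<open>m_assoc\<close> hides
    \<open>e \<otimes> e\<close>; this form still applies inside longer products.\<close>
  have ee_left: "e \<otimes> (e \<otimes> x) = e \<otimes> x" if "x \<in> carrier R" for x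
    using ec ee that by (simp flip: m_assoc)
  have "e \<otimes> r = r \<otimes> e" if r: "r \<in> carrier R" for r
  proof -
    have "e \<otimes> r \<ominus> e \<otimes> r \<otimes> e = \<zero>"
      by (rule square_zero_eq_zero[OF assms e])
         (use ec r in \<open>simp_all add: minus_eq l_distr r_distr l_minus r_minus m_assoc ee ee_left r_neg l_neg\<close>)
    moreover have "r \<otimes> e \<ominus> e \<otimes> r \<otimes> e = \<zero>"
      by (rule square_zero_eq_zero[OF assms e])
         (use ec r in \<open>simp_all add: minus_eq l_distr r_distr l_minus r_minus m_assoc ee ee_left r_neg l_neg\<close>)
    ultimately show ?thesis
      using ec r by (metis m_closed r_right_minus_eq)
  qed
  with ec show "e \<in> ring_center R"
    by (simp add: ring_center_def)
qed

section \<open>Uniqueness from commuting idempotents\<close>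

lemma commuting_Idempotents_diff_in_Delta:
  assumes "e \<in> Idempotents R" "f \<in> Idempotents R" "e \<otimes> f = f \<otimes> e"
    and D: "e \<ominus> f \<in> Delta R"
  shows "e = f"
proof -
  have c: "e \<in> carrier R" "f \<in> carrier R" "e \<otimes> e = e" "f \<otimes> f = f"
    using assms by (simp_all add: Idempotents_def)
  define u where "u = \<one> \<ominus> (f \<oplus> f)"
  define g where "g = (e \<ominus> f) \<otimes> u"
  have u: "u \<in> carrier R" "u \<otimes> u = \<one>"
    using c by (simp_all add: u_def minus_eq l_distr r_distr l_minus r_minus minus_add a_ac add_cancels)
  have left: "e \<otimes> (e \<otimes> x) = e \<otimes> x" "f \<otimes> (f \<otimes> x) = f \<otimes> x" "f \<otimes> (e \<otimes> x) = e \<otimes> (f \<otimes> x)"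
    if "x \<in> carrier R" for x
    using c that assms(3) by (simp_all flip: m_assoc)
  have gc: "g \<in> carrier R"
    using c u by (simp add: g_def)
  \<comment> \<open>Both sides expand to e - 2ef + f, since \<open>e\<close> and \<open>f\<close>
    commute.\<close>
  have "g = (e \<ominus> f) \<otimes> (e \<ominus> f)"
    using c assms(3)[symmetric] unfolding g_def u_def
    by (simp add: minus_eq l_distr r_distr l_minus r_minus minus_add left a_ac add_cancels)
  \<comment> \<open>For commuting idempotents (e - f)^3 = e - f, so the square of e - f is
    idempotent.\<close>
  then have "g \<otimes> g = g"
    using c assms(3)[symmetric]
    by (simp add: minus_eq l_distr r_distr l_minus r_minus minus_add m_assoc left a_ac add_cancels)
  then have "(\<one> \<ominus> g) \<otimes> (\<one> \<ominus> g) = \<one> \<ominus> g"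
    using gc by (simp add: minus_eq l_distr r_distr l_minus r_minus l_neg r_neg)
  moreover have "\<one> \<ominus> g \<in> Units R"
    using D Units_memI[OF u(1) u(1) u(2) u(2)] by (simp add: g_def Delta_def)
  ultimately have "\<one> \<ominus> g = \<one>"
    using idempotent_unit_eq_one by blast
  then have "\<ominus> g = \<zero>"
    using gc by (simp add: minus_eq)
  then have "g = \<zero>"
    using gc by (metis minus_minus minus_zero)
  \<comment> \<open>Multiplying \<open>g\<close> by \<open>u\<close> on the right recovers e - f,
    because \<open>u\<close> squares to one.\<close>
  then have "e \<ominus> f = \<zero>"
    using c u by (metis g_def l_null m_assoc minus_closed r_one)
  then show ?thesis
    using c by simp
qed

lemma central_strongly_Delta_clean_imp_uniquely:
  assumes "strongly_Delta_clean R" "Idempotents R \<subseteq> ring_center R"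
  shows "uniquely_Delta_clean R"
  unfolding uniquely_Delta_clean_def
proof
  fix a assume "a \<in> carrier R"
  then obtain e d where e: "e \<in> Idempotents R" and d: "d \<in> Delta R" and a: "a = e \<oplus> d"
    using assms(1) unfolding strongly_Delta_clean_def by blast
  have "f = e \<and> d' = d" if f: "f \<in> Idempotents R" and d': "d' \<in> Delta R" and eq: "a = f \<oplus> d'" for f d'
  proof -
    have c: "e \<in> carrier R" "f \<in> carrier R" "d \<in> carrier R" "d' \<in> carrier R"
      using e f d d' by (simp_all add: Idempotents_def Delta_closed)
    have "e = a \<oplus> \<ominus> d"
      using a c by (simp add: a_assoc r_neg)
    \<comment> \<open>Equating the two representations of \<open>a\<close> turns a difference of
      idempotents into a difference of elements of \<open>Delta R\<close>.\<close>
    then have "e \<ominus> f = d' \<oplus> \<ominus> d"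
      using eq c by (simp add: minus_eq a_ac add_cancels)
    then have "e \<ominus> f \<in> Delta R"
      using d d' by (simp add: Delta_add Delta_a_inv)
    moreover have "e \<otimes> f = f \<otimes> e"
      using e assms(2) c by (auto simp: ring_center_def)
    ultimately have "e = f"
      using e f commuting_Idempotents_diff_in_Delta by blast
    then show ?thesis
      using a eq c by simp
  qed
  then show "\<exists>!p. p \<in> Idempotents R \<times> Delta R \<and> a = fst p \<oplus> snd p"
    using e d a by (intro ex1I[of _ "(e, d)"]) auto
qed

end

theorem theorem3p4:
  fixes R :: "('a, 'm) ring_scheme"
  assumes "ring R"
  shows "uniquely_Delta_clean R \<longleftrightarrow>
         strongly_Delta_clean R \<and> Idempotents R \<subseteq> ring_center R"
proof -
  interpret ring R
    by (rule assms)
  have "strongly_Delta_clean R" if u: "uniquely_Delta_clean R"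
    unfolding strongly_Delta_clean_def
  proof
    fix a assume "a \<in> carrier R"
    with u obtain e d where "e \<in> Idempotents R" "d \<in> Delta R" "a = e \<oplus>\<^bsub>R\<^esub> d"
      by (rule uniquely_Delta_clean_exists)
    \<comment> \<open>The representation at hand already commutes, because its idempotent is
      central.\<close>
    moreover from this have "e \<otimes>\<^bsub>R\<^esub> d = d \<otimes>\<^bsub>R\<^esub> e"
      using uniquely_Delta_clean_Idempotents_central[OF u] Delta_closed
      by (auto simp: ring_center_def)
    ultimately show "\<exists>e \<in> Idempotents R. \<exists>d \<in> Delta R.
        a = e \<oplus>\<^bsub>R\<^esub> d \<and> e \<otimes>\<^bsub>R\<^esub> d = d \<otimes>\<^bsub>R\<^esub> e"
      by blast
  qed
  then show ?thesis
    using uniquely_Delta_clean_Idempotents_central central_strongly_Delta_clean_imp_uniquely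
    by blast
qed

end
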